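(* For all $n\ge 1$ and $1\le i\le n$, the members of $\mathcal{S}_{n,i}(1342,1432)$ having a prescribed set of left-right minima in specified positions are in one-to-one correspondence with the members of $\mathcal{S}_{n,i}(1234,1243)$ having the same set of left-right minima in the same positions; that is, for every set $M\subseteq[n]\times[n]$, the set of $\pi\in\mathcal{S}_{n,i}(1342,1432)$ with $\{(j,\pi_j): \pi_j \text{ is a left-right minimum of }\pi\}=M$ is in bijection with the set of $\pi\in\mathcal{S}_{n,i}(1234,1243)$ with $\{(j,\pi_j): \pi_j \text{ is a left-right minimum of }\pi\}=M$. In particular, $|\mathcal{S}_{n,i}(1342,1432)|=S_{n,i}$.
   Context: A permutation $\pi=\pi_1\cdots\pi_n$ of $[n]=\{1,\dots,n\}$ contains the pattern $\tau=\tau_1\cdots\tau_k\in\mathcal{S}_k$ if there are indices $i_1<\cdots<i_k$ such that $\pi_{i_1}\cdots\pi_{i_k}$ is order isomorphic to $\tau$; otherwise $\pi$ avoids $\tau$. $\mathcal{S}_{n,i}(\sigma,\tau)$ denotes the set of permutations $\pi_1\cdots\pi_n$ of $[n]$ avoiding both $\sigma$ and $\tau$ with $\pi_1=i$. An entry $\pi_j$ is a left-right minimum of $\pi$ if $\pi_j<\pi_k$ for all $k<j$. The array $S_{n,k}$ ($1\le k\le n$) is defined by $S_{1,1}=S_{2,1}=S_{2,2}=1$ and, for $n\ge 3$, $$S_{n,k}=S_{n,k-1}+2S_{n-1,k}-S_{n-1,k-1},\qquad 1\le k\le n-2,$$ together with $S_{n,n}=S_{n,n-1}=S_{n,n-2}$,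 where $S_{m,0}=0$ for all $m$. *)

theory Defs
  imports "HOL-Combinatorics.Multiset_Permutations"
begin

text \<open>
  A permutation of \<open>{1..n}\<close> is represented by its one-line notation, i.e.\ as an element of
  \<^term>\<open>permutations_of_set {1..n}\<close>. List indices start at 0, so the entry
  \<open>\<pi>\<^sub>j\<close> is \<open>\<pi> ! (j - 1)\<close>.
\<close>

definition order_isomorphic :: "nat list \<Rightarrow> nat list \<Rightarrow> bool" where
  "order_isomorphic xs ys \<longleftrightarrow> length xs = length ys \<and>
     (\<forall>a < length xs. \<forall>b < length xs. xs ! a < xs ! b \<longleftrightarrow> ys ! a < ys ! b)"

definition contains_pattern :: "nat list \<Rightarrow> nat list \<Rightarrow> bool" where
  "contains_pattern \<pi> \<tau> \<longleftrightarrow>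
     (\<exists>f. strict_mono_on {..<length \<tau>} f \<and> f ` {..<length \<tau>} \<subseteq> {..<length \<pi>} \<and>
          order_isomorphic (map (\<lambda>a. \<pi> ! f a) [0..<length \<tau>]) \<tau>)"

definition avoids :: "nat list \<Rightarrow> nat list \<Rightarrow> bool" where
  "avoids \<pi> \<tau> \<longleftrightarrow> \<not> contains_pattern \<pi> \<tau>"

text \<open>Only meaningful for \<open>n \<ge> 1\<close>, since it refers to the first entry.\<close>

definition avoiders :: "nat \<Rightarrow> nat \<Rightarrow> nat list \<Rightarrow> nat list \<Rightarrow> nat list set" where
  "avoiders n i \<sigma> \<tau> =
     {\<pi> \<in> permutations_of_set {1..n}. avoids \<pi> \<sigma> \<and> avoids \<pi> \<tau> \<and> \<pi> ! 0 = i}"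

text \<open>Pairs of a (1-based) position and the left-right minimum at that position.\<close>

definition lr_minima :: "nat list \<Rightarrow> (nat \<times> nat) set" where
  "lr_minima \<pi> = {(Suc j, \<pi> ! j) | j. j < length \<pi> \<and> (\<forall>k<j. \<pi> ! j < \<pi> ! k)}"

text \<open>
  The array is integer valued so that the subtraction is not truncated. Entries outside
  \<open>1 \<le> k \<le> n\<close> are 0; of these, only those with \<open>k = 0\<close> are used by the recurrence.
\<close>

function schroeder_array :: "nat \<Rightarrow> nat \<Rightarrow> int" where
  "schroeder_array n k =
     (if k = 0 \<or> n < k then 0
      else if n \<le> 2 then 1
      else if k \<le> n - 2 then
        schroeder_array n (k - 1) + 2 * schroeder_array (n - 1) k - schroeder_array (n - 1) (k - 1)
      else schroeder_array n (n - 2))"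
  by auto
termination by (relation "measures [fst, snd]") auto

declare schroeder_array.simps [simp del]

end

theory Submission imports Defs "HOL-Library.FuncSet" begin

text \<open>
  Fix the left-right minima, hence their positions, and consider the remaining values in
  increasing order. A remaining value \<open>v\<close> has to be placed after the first minimum that
  is smaller than \<open>v\<close>; call the positions after that minimum that are neither minima nor taken
  by smaller values the free positions for \<open>v\<close>. They are exactly the positions that \<open>v\<close> itself
  and the larger values after that minimum occupy in the end.

  In both pattern pairs the \<open>1\<close> may be taken to be a left-right minimum. A permutation
  avoids 1342 and 1432 iff there is at most one larger value between \<open>v\<close> and the first minimum
  smaller than \<open>v\<close>, that is, iff every \<open>v\<close> takes one of the first two free positions
  (\<open>avoids_1342_1432_iff_first_two\<close>). It avoids 1234 and 1243 iff there is at most one larger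
  value to the right of \<open>v\<close>, that is, iff every \<open>v\<close> takes one of the last two free positions
  (\<open>avoids_1234_1243_iff_last_two\<close>).

  For \<open>w < v\<close> the first minimum smaller than \<open>v\<close> does not come after the first minimum smaller
  than \<open>w\<close>, so all the smaller values have used up positions that would be free for \<open>v\<close>. Hence
  the number of free positions for \<open>v\<close> does not depend on how the smaller values were placed,
  and both classes are counted by the same product (\<open>card_placements\<close>).

  The cardinality is then computed for 1234 and 1243. Let \<open>k\<close> be the first entry of a permutation
  of \<open>{1..m+1}\<close>. If the second entry is smaller than \<open>k\<close>, deleting \<open>k\<close> leaves an arbitrary
  avoider with that first entry. If it is larger than \<open>k\<close>, it is followed by at most one larger
  entry, so it is \<open>m\<close> or \<open>m+1\<close>, and deleting it leaves an arbitrary avoider with first entry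
  \<open>k\<close> (\<open>tails_Suc\<close>). The array satisfies the same recurrence in summed form
  (\<open>schroeder_array_Suc\<close>).
\<close>

section \<open>Patterns\<close>

lemma contains_pattern_length_4:
  "contains_pattern \<pi> [s,t,u,v] \<longleftrightarrow>
     (\<exists>a b c d. a < b \<and> b < c \<and> c < d \<and> d < length \<pi> \<and>
        order_isomorphic [\<pi> ! a, \<pi> ! b, \<pi> ! c, \<pi> ! d] [s,t,u,v])" (is "?L \<longleftrightarrow> ?R")
proof
  have upt: "[0..<4] = [0, 1, 2, 3::nat]" by (simp add: upt_rec)
  {
    assume ?L
    then obtain f where f: "strict_mono_on {..<4} f" "f ` {..<4::nat} \<subseteq> {..<length \<pi>}"
      "order_isomorphic (map (\<lambda>a. \<pi> ! f a) [0..<4]) [s,t,u,v]"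
      by (auto simp: contains_pattern_def numeral_eq_Suc)
    have "f 0 < f 1" "f 1 < f 2" "f 2 < f 3"
      using f(1) by (auto simp: strict_mono_on_def)
    moreover have "f 3 < length \<pi>" using f(2) by (simp add: image_subset_iff)
    moreover have "order_isomorphic [\<pi> ! f 0, \<pi> ! f 1, \<pi> ! f 2, \<pi> ! f 3] [s,t,u,v]"
      using f(3) by (simp add: upt)
    ultimately show ?R by blast
  next
    assume ?R
    then obtain a b c d where *: "a < b" "b < c" "c < d" "d < length \<pi>"
      "order_isomorphic [\<pi> ! a, \<pi> ! b, \<pi> ! c, \<pi> ! d] [s,t,u,v]" by blast
    define f where "f = (!) [a,b,c,d]"
    have "strict_mono_on {..<4} f"
    proof (rule strict_mono_onI)
      fix r s :: nat assume "r \<in> {..<4}" "s \<in> {..<4}" "r < s"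
      then have "r \<in> {0,1,2,3}" "s \<in> {0,1,2,3}" by auto
      then show "f r < f s" using \<open>r < s\<close> *(1-3) by (auto simp: f_def)
    qed
    moreover have "f ` {..<4} \<subseteq> {..<length \<pi>}"
    proof -
      have "{..<4} = {0,1,2,3::nat}" by auto
      then show ?thesis using * by (simp add: f_def)
    qed
    moreover have "order_isomorphic (map (\<lambda>a. \<pi> ! f a) [0..<4]) [s,t,u,v]"
      using *(5) by (simp add: upt f_def)
    ultimately show ?L unfolding contains_pattern_def
      by (intro exI[of _ f]) (simp add: numeral_eq_Suc)
  }
qed

lemma all_less_4: "(\<forall>a<Suc (Suc (Suc (Suc 0))). P a) \<longleftrightarrow> P 0 \<and> P 1 \<and> P 2 \<and> P 3"
  by (auto simp: less_Suc_eq numeral_eq_Suc)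

lemma order_isomorphic_patterns:
  "order_isomorphic [x,y,z,w] [1,2,3,4] \<longleftrightarrow> x < y \<and> y < z \<and> z < w"
  "order_isomorphic [x,y,z,w] [1,2,4,3] \<longleftrightarrow> x < y \<and> y < w \<and> w < z"
  "order_isomorphic [x,y,z,w] [1,3,4,2] \<longleftrightarrow> x < w \<and> w < y \<and> y < z"
  "order_isomorphic [x,y,z,w] [1,4,3,2] \<longleftrightarrow> x < w \<and> w < z \<and> z < y"
  unfolding order_isomorphic_def by (auto simp: all_less_4)

text \<open>
  The two patterns of a pair differ only in the order of their two largest letters, so avoiding
  both means that no two larger entries occur at all, in whatever order.
\<close>

lemma avoids_1234_1243_iff:
  assumes "distinct \<pi>"
  shows "avoids \<pi> [1,2,3,4] \<and> avoids \<pi> [1,2,4,3] \<longleftrightarrow>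
    \<not> (\<exists>a b c d. a < b \<and> b < c \<and> c < d \<and> d < length \<pi> \<and>
         \<pi> ! a < \<pi> ! b \<and> \<pi> ! b < \<pi> ! c \<and> \<pi> ! b < \<pi> ! d)"
proof -
  have "(a < b \<and> b < c \<and> c < d \<and> d < length \<pi> \<and> \<pi> ! a < \<pi> ! b \<and> \<pi> ! b < \<pi> ! c \<and> \<pi> ! b < \<pi> ! d) \<longleftrightarrow>
    (a < b \<and> b < c \<and> c < d \<and> d < length \<pi> \<and> \<pi> ! a < \<pi> ! b \<and> \<pi> ! b < \<pi> ! c \<and> \<pi> ! c < \<pi> ! d) \<or>
    (a < b \<and> b < c \<and> c < d \<and> d < length \<pi> \<and> \<pi> ! a < \<pi> ! b \<and> \<pi> ! b < \<pi> ! d \<and> \<pi> ! d < \<pi> ! c)"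
    for a b c d
    using nth_eq_iff_index_eq[OF assms, of c d] by auto
  then show ?thesis
    unfolding avoids_def contains_pattern_length_4 order_isomorphic_patterns
    by (simp only: ex_disj_distrib de_Morgan_disj)
qed

lemma avoids_1342_1432_iff:
  assumes "distinct \<pi>"
  shows "avoids \<pi> [1,3,4,2] \<and> avoids \<pi> [1,4,3,2] \<longleftrightarrow>
    \<not> (\<exists>a b c d. a < b \<and> b < c \<and> c < d \<and> d < length \<pi> \<and>
         \<pi> ! a < \<pi> ! d \<and> \<pi> ! d < \<pi> ! b \<and> \<pi> ! d < \<pi> ! c)"
proof -
  have "(a < b \<and> b < c \<and> c < d \<and> d < length \<pi> \<and> \<pi> ! a < \<pi> ! d \<and> \<pi> ! d < \<pi> ! b \<and> \<pi> ! d < \<pi> ! c) \<longleftrightarrow>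
    (a < b \<and> b < c \<and> c < d \<and> d < length \<pi> \<and> \<pi> ! a < \<pi> ! d \<and> \<pi> ! d < \<pi> ! b \<and> \<pi> ! b < \<pi> ! c) \<or>
    (a < b \<and> b < c \<and> c < d \<and> d < length \<pi> \<and> \<pi> ! a < \<pi> ! d \<and> \<pi> ! d < \<pi> ! c \<and> \<pi> ! c < \<pi> ! b)"
    for a b c d
    using nth_eq_iff_index_eq[OF assms, of b c] by auto
  then show ?thesis
    unfolding avoids_def contains_pattern_length_4 order_isomorphic_patterns
    by (simp only: ex_disj_distrib de_Morgan_disj)
qed

section \<open>Greedy placements\<close>

definition first_two :: "nat set \<Rightarrow> nat set" where
  "first_two S = {q \<in> S. card {x \<in> S. x < q} < 2}"

definition last_two :: "nat set \<Rightarrow> nat set" where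
  "last_two S = {q \<in> S. card {x \<in> S. q < x} < 2}"

text \<open>
  A new maximum has all of the old set below it and leaves the counts of the old elements as they
  are; it is therefore added precisely as long as the old set has fewer than \<open>k\<close> elements.
\<close>

lemma card_with_few_below:
  fixes S :: "'a::linorder set"
  assumes "finite S"
  shows "card {q \<in> S. card {x \<in> S. x < q} < k} = min k (card S)"
  using assms
proof (induction S rule: finite_linorder_max_induct)
  case (insert b S)
  have "{x \<in> insert b S. x < b} = S" using insert.hyps(2) by auto
  moreover have "{x \<in> insert b S. x < q} = {x \<in> S. x < q}" if "q \<in> S" for q
    using insert.hyps(2) that by auto
  ultimately have "{q \<in> insert b S. card {x \<in> insert b S. x < q} < k} =
      (if card S < k then insert b {q \<in> S. card {x \<in> S. x < q} < k}
       else {q \<in> S. card {x \<in> S. x < q} < k})"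
    by (simp add: Collect_conv_if2 conj_disj_distribR Collect_disj_eq cong: conj_cong)
  moreover have "b \<notin> S" using insert.hyps(2) by auto
  ultimately show ?case
    using insert.IH insert.hyps(1) by (cases "card S < k") (simp_all add: card_insert_if)
qed simp

lemma card_with_few_above:
  fixes S :: "'a::linorder set"
  assumes "finite S"
  shows "card {q \<in> S. card {x \<in> S. q < x} < k} = min k (card S)"
  using assms
proof (induction S rule: finite_linorder_min_induct)
  case (insert b S)
  have "{x \<in> insert b S. b < x} = S" using insert.hyps(2) by auto
  moreover have "{x \<in> insert b S. q < x} = {x \<in> S. q < x}" if "q \<in> S" for q
    using insert.hyps(2) that by auto
  ultimately have "{q \<in> insert b S. card {x \<in> insert b S. q < x} < k} =
      (if card S < k then insert b {q \<in> S. card {x \<in> S. q < x} < k}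
       else {q \<in> S. card {x \<in> S. q < x} < k})"
    by (simp add: Collect_conv_if2 conj_disj_distribR Collect_disj_eq cong: conj_cong)
  moreover have "b \<notin> S" using insert.hyps(2) by auto
  ultimately show ?case
    using insert.IH insert.hyps(1) by (cases "card S < k") (simp_all add: card_insert_if)
qed simp

text \<open>
  The functions \<open>g\<close> from values to positions in \<open>Q\<close> that arise by treating the values in
  increasing order and choosing the position of \<open>v\<close> by the rule \<open>C\<close> among the positions after
  \<open>l v\<close> that no smaller value has taken. Extensionality makes these sets of functions finite.
\<close>

definition placements ::
  "(nat set \<Rightarrow> nat set) \<Rightarrow> (nat \<Rightarrow> nat) \<Rightarrow> nat set \<Rightarrow> nat set \<Rightarrow> (nat \<Rightarrow> nat) set" where
  "placements C l Q R =
     {g \<in> extensional R. \<forall>v \<in> R. g v \<in> C {q \<in> Q. l v < q \<and> q \<notin> g ` {w \<in> R. w < v}}}"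

lemma placements_inj_on:
  assumes "\<And>S. C S \<subseteq> S" and "g \<in> placements C l Q R"
  shows "inj_on g R"
proof (rule linorder_inj_onI')
  fix w v assume "w \<in> R" "v \<in> R" "w < v"
  then have "g v \<notin> g ` {w \<in> R. w < v}"
    using assms unfolding placements_def by blast
  then show "g w \<noteq> g v" using \<open>w \<in> R\<close> \<open>w < v\<close> by (metis (mono_tags, lifting) imageI mem_Collect_eq)
qed

lemma placements_range:
  assumes "\<And>S. C S \<subseteq> S" and "g \<in> placements C l Q R" and "v \<in> R"
  shows "g v \<in> Q" and "l v < g v"
  using assms unfolding placements_def by blast+

text \<open>
  The largest value is placed last, so a placement is a placement of the other values together
  with one further choice.
\<close>

lemma placements_insert:
  assumes "\<And>w. w \<in> R \<Longrightarrow> w < v"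
  shows "placements C l Q (insert v R) =
    (\<lambda>(g, q). g(v := q)) `
      (SIGMA g : placements C l Q R. C {q \<in> Q. l v < q \<and> q \<notin> g ` R})" (is "?P = ?h ` ?S")
proof -
  have v: "v \<notin> R" using assms by auto
  have below: "{w \<in> insert v R. w < v} = R" using assms by auto
  have below': "{w \<in> insert v R. w < u} = {w \<in> R. w < u}" if "u \<in> R" for u
    using assms[OF that] by auto
  show ?thesis
  proof (intro equalityI subsetI)
    fix g assume g: "g \<in> ?P"
    let ?g = "restrict g R"
    have "?g ` {w \<in> R. w < u} = g ` {w \<in> R. w < u}" for u by auto
    then have "?g \<in> placements C l Q R"
      using g below' by (auto simp: placements_def)
    moreover have "?g ` R = g ` R" by auto
    then have "g v \<in> C {q \<in> Q. l v < q \<and> q \<notin> ?g ` R}"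
      using g below by (simp add: placements_def)
    moreover have "g = ?g(v := g v)"
      using g by (auto simp: placements_def fun_eq_iff extensional_def)
    ultimately show "g \<in> ?h ` ?S" by (intro image_eqI[of _ _ "(?g, g v)"]) auto
  next
    fix g' assume "g' \<in> ?h ` ?S"
    then obtain g q where g: "g' = g(v := q)" "g \<in> placements C l Q R"
      "q \<in> C {q \<in> Q. l v < q \<and> q \<notin> g ` R}" by auto
    have im: "g' ` T = g ` T" if "T \<subseteq> R" for T using v that g(1) by (auto simp: image_iff)
    have "g' u \<in> C {q \<in> Q. l u < q \<and> q \<notin> g' ` {w \<in> insert v R. w < u}}" if "u \<in> insert v R" for u
    proof (cases "u = v")
      case True
      then show ?thesis using g im[of R] below by simp
    next
      case False
      then have "u \<in> R" using that by simp
      then have "g' ` {w \<in> insert v R. w < u} = g ` {w \<in> R. w < u}" 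
        using im[of "{w \<in> R. w < u}"] below' by auto
      then show ?thesis using \<open>u \<in> R\<close> False g by (simp add: placements_def)
    qed
    moreover have "g' \<in> extensional (insert v R)"
      using g by (auto simp: placements_def extensional_def)
    ultimately show "g' \<in> ?P" unfolding placements_def by blast
  qed
qed

text \<open>
  As \<open>l\<close> is antitone, every smaller value \<open>w\<close> sits beyond \<open>l w \<ge> l v\<close> and thus occupies one of
  the positions of \<open>Q\<close> after \<open>l v\<close>. The number of positions left for \<open>v\<close> is therefore the same
  for all placements of the smaller values, and it is independent of which positions among them
  the rule \<open>C\<close> admits.
\<close>

lemma card_placements:
  assumes C: "\<And>S. C S \<subseteq> S" "\<And>S. finite S \<Longrightarrow> card (C S) = min k (card S)"
    and "finite Q" and "finite R"
    and "\<And>v w. v \<in> R \<Longrightarrow> w \<in> R \<Longrightarrow> v \<le> w \<Longrightarrow> l w \<le> l v"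
  shows "finite (placements C l Q R) \<and> card (placements C l Q R) =
    (\<Prod>v\<in>R. min k (card {q \<in> Q. l v < q} - card {w \<in> R. w < v}))"
  using assms(4,5)
proof (induction R rule: finite_linorder_max_induct)
  case empty
  have "placements C l Q {} = {\<lambda>_. undefined}" by (auto simp: placements_def)
  then show ?case by simp
next
  case (insert v R)
  have v: "v \<notin> R" using insert.hyps by auto
  let ?N = "min k (card {q \<in> Q. l v < q} - card R)"
  let ?F = "\<lambda>g. {q \<in> Q. l v < q \<and> q \<notin> g ` R}"
  have choices: "card (C (?F g)) = ?N" if g: "g \<in> placements C l Q R" for g
  proof -
    have "l v < g w" if "w \<in> R" for w
      using placements_range(2)[OF C(1) g that] insert.prems[of w v] insert.hyps(2) that
      by fastforce
    then have "g ` R \<subseteq> {q \<in> Q. l v < q}"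
      using placements_range(1)[OF C(1) g] by auto
    moreover have "card (g ` R) = card R"
      using placements_inj_on[OF C(1) g] by (rule card_image)
    moreover have "?F g = {q \<in> Q. l v < q} - g ` R" by auto
    ultimately show ?thesis
      using C(2)[of "?F g"] assms(3) insert.hyps(1) by (simp add: card_Diff_subset)
  qed
  have IH: "finite (placements C l Q R)" "card (placements C l Q R) =
    (\<Prod>v\<in>R. min k (card {q \<in> Q. l v < q} - card {w \<in> R. w < v}))"
    using insert.IH insert.prems by auto
  let ?S = "SIGMA g : placements C l Q R. C (?F g)"
  have ins: "placements C l Q (insert v R) = (\<lambda>(g, q). g(v := q)) ` ?S"
    using insert.hyps(2) by (intro placements_insert) blast
  have fin: "finite (C (?F g))" for g using C(1)[of "?F g"] assms(3) finite_subset by fastforce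
  have "inj_on (\<lambda>(g, q). g(v := q)) ?S"
  proof (rule inj_onI, clarify)
    fix g q g' q'
    assume *: "g \<in> placements C l Q R" "g' \<in> placements C l Q R" and eq: "g(v := q) = g'(v := q')"
    have "g v = g' v" using * v by (simp add: placements_def extensional_def)
    then show "g = g' \<and> q = q'" using eq by (metis fun_upd_eqD fun_upd_triv fun_upd_upd)
  qed
  then have "card (placements C l Q (insert v R)) = card ?S"
    unfolding ins by (rule card_image)
  also have "\<dots> = card (placements C l Q R) * ?N"
    using IH(1) fin choices by (simp add: card_SigmaI)
  also have "\<dots> = (\<Prod>u\<in>insert v R. min k (card {q \<in> Q. l u < q} - card {w \<in> insert v R. w < u}))"
  proof -
    have "{w \<in> insert v R. w < v} = R" using insert.hyps by auto
    moreover have "{w \<in> insert v R. w < u} = {w \<in> R. w < u}" if "u \<in> R" for u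
      using insert.hyps(2) that by force
    ultimately show ?thesis using v insert.hyps(1) IH(2) by (simp add: mult.commute)
  qed
  moreover have "finite (placements C l Q (insert v R))"
    unfolding ins
    using IH(1) fin by (intro finite_imageI finite_SigmaI)
  ultimately show ?case by simp
qed

corollary card_placements_first_two_eq_last_two:
  assumes "finite Q" and "finite R"
    and "\<And>v w. v \<in> R \<Longrightarrow> w \<in> R \<Longrightarrow> v \<le> w \<Longrightarrow> l w \<le> l v"
  shows "finite (placements first_two l Q R)" and "finite (placements last_two l Q R)"
    and "card (placements first_two l Q R) = card (placements last_two l Q R)"
proof -
  have "first_two S \<subseteq> S" "last_two S \<subseteq> S" for S by (auto simp: first_two_def last_two_def)
  moreover have "card (first_two S) = min 2 (card S)" "card (last_two S) = min 2 (card S)" 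
    if "finite S" for S
    using card_with_few_below[OF that] card_with_few_above[OF that]
    by (simp_all add: first_two_def last_two_def)
  ultimately show "finite (placements first_two l Q R)" "finite (placements last_two l Q R)"
    "card (placements first_two l Q R) = card (placements last_two l Q R)"
    using card_placements[of first_two 2 Q R l] card_placements[of last_two 2 Q R l] assms by auto
qed

section \<open>Left-right minima\<close>

definition position :: "nat list \<Rightarrow> nat \<Rightarrow> nat" where
  "position \<pi> = inv_into {..<length \<pi>} ((!) \<pi>)"

text \<open>
  The first entry below \<open>v\<close> is always a left-right minimum, so for a permutation this function is
  determined by the left-right minima (\<open>first_below_cong\<close>).
\<close>

definition first_below :: "nat list \<Rightarrow> nat \<Rightarrow> nat" where
  "first_below \<pi> v = (LEAST j. j < length \<pi> \<and> \<pi> ! j < v)"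

definition nonmin_values :: "nat list \<Rightarrow> nat set" where
  "nonmin_values \<pi> = set \<pi> - snd ` lr_minima \<pi>"

definition nonmin_positions :: "nat list \<Rightarrow> nat set" where
  "nonmin_positions \<pi> = {j. j < length \<pi> \<and> Suc j \<notin> fst ` lr_minima \<pi>}"

lemma position_nth: "distinct \<pi> \<Longrightarrow> j < length \<pi> \<Longrightarrow> position \<pi> (\<pi> ! j) = j"
  unfolding position_def by (simp add: inj_on_nth inv_into_f_f)

lemma
  assumes "v \<in> set \<pi>"
  shows position_less: "position \<pi> v < length \<pi>" and nth_position: "\<pi> ! position \<pi> v = v"
proof -
  have v: "v \<in> (!) \<pi> ` {..<length \<pi>}" using assms by (auto simp: in_set_conv_nth)
  then show "position \<pi> v < length \<pi>" "\<pi> ! position \<pi> v = v"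
    unfolding position_def using inv_into_into[OF v] f_inv_into_f[OF v] by simp_all
qed

lemma lr_minima_iff:
  "(Suc j, v) \<in> lr_minima \<pi> \<longleftrightarrow> j < length \<pi> \<and> v = \<pi> ! j \<and> (\<forall>k<j. v < \<pi> ! k)"
  unfolding lr_minima_def by auto

lemma nonmin_positions_iff:
  "j \<in> nonmin_positions \<pi> \<longleftrightarrow> j < length \<pi> \<and> \<not> (\<forall>k<j. \<pi> ! j < \<pi> ! k)"
  unfolding nonmin_positions_def lr_minima_def by force

lemma nonmin_values_iff:
  assumes "distinct \<pi>"
  shows "v \<in> nonmin_values \<pi> \<longleftrightarrow> v \<in> set \<pi> \<and> position \<pi> v \<in> nonmin_positions \<pi>"
proof -
  have "v \<in> snd ` lr_minima \<pi> \<longleftrightarrow> (\<forall>k<position \<pi> v. v < \<pi> ! k)" if "v \<in> set \<pi>"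
  proof
    assume "v \<in> snd ` lr_minima \<pi>"
    then obtain j where "j < length \<pi>" "v = \<pi> ! j" "\<forall>k<j. \<pi> ! j < \<pi> ! k"
      unfolding lr_minima_def by auto
    then show "\<forall>k<position \<pi> v. v < \<pi> ! k" using position_nth[OF assms, of j] by simp
  next
    assume "\<forall>k<position \<pi> v. v < \<pi> ! k"
    then have "(Suc (position \<pi> v), v) \<in> lr_minima \<pi>"
      using position_less[OF that] nth_position[OF that] by (simp add: lr_minima_iff)
    then show "v \<in> snd ` lr_minima \<pi>" by force
  qed
  then show ?thesis
    using position_less[of v \<pi>] nth_position[of v \<pi>]
    by (cases "v \<in> set \<pi>") (simp_all add: nonmin_values_def nonmin_positions_iff)
qed

lemma bij_betw_position:
  assumes "distinct \<pi>"
  shows "bij_betw (position \<pi>) (set \<pi>) {..<length \<pi>}"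
  unfolding position_def
  by (intro bij_betw_inv_into bij_betw_nth) (use assms in auto)

lemma bij_betw_position_nonmin:
  assumes "distinct \<pi>"
  shows "bij_betw (position \<pi>) (nonmin_values \<pi>) (nonmin_positions \<pi>)"
proof (rule bij_betw_imageI)
  have "nonmin_values \<pi> \<subseteq> set \<pi>" by (auto simp: nonmin_values_def)
  then show "inj_on (position \<pi>) (nonmin_values \<pi>)"
    using bij_betw_position[OF assms] by (meson bij_betw_imp_inj_on inj_on_subset)
  show "position \<pi> ` nonmin_values \<pi> = nonmin_positions \<pi>"
  proof (intro equalityI subsetI)
    fix j assume "j \<in> nonmin_positions \<pi>"
    moreover from this have "j < length \<pi>" by (simp add: nonmin_positions_iff)
    ultimately show "j \<in> position \<pi> ` nonmin_values \<pi>"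
      using nonmin_values_iff[OF assms, of "\<pi> ! j"] position_nth[OF assms, of j] by force
  qed (auto simp: nonmin_values_iff[OF assms])
qed

lemma first_below:
  assumes "\<exists>j<length \<pi>. \<pi> ! j < v"
  shows "first_below \<pi> v < length \<pi>" and "\<pi> ! first_below \<pi> v < v"
    and "(Suc (first_below \<pi> v), \<pi> ! first_below \<pi> v) \<in> lr_minima \<pi>"
proof -
  show *: "first_below \<pi> v < length \<pi>" "\<pi> ! first_below \<pi> v < v"
    using LeastI_ex[of "\<lambda>j. j < length \<pi> \<and> \<pi> ! j < v"] assms unfolding first_below_def by auto
  have "v \<le> \<pi> ! k" if "k < first_below \<pi> v" for k
    using not_less_Least[of k "\<lambda>j. j < length \<pi> \<and> \<pi> ! j < v"] that *(1)
    unfolding first_below_def by auto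
  then show "(Suc (first_below \<pi> v), \<pi> ! first_below \<pi> v) \<in> lr_minima \<pi>"
    using * by (fastforce simp: lr_minima_iff)
qed

lemma first_below_le: "j < length \<pi> \<Longrightarrow> \<pi> ! j < v \<Longrightarrow> first_below \<pi> v \<le> j"
  unfolding first_below_def by (rule Least_le) simp

lemma nonmin_value_has_smaller:
  assumes "distinct \<pi>" and "v \<in> nonmin_values \<pi>"
  shows "\<exists>j<position \<pi> v. \<pi> ! j < v"
proof -
  have v: "v \<in> set \<pi>" and "position \<pi> v \<in> nonmin_positions \<pi>"
    using assms nonmin_values_iff by auto
  then obtain k where k: "k < position \<pi> v" "\<pi> ! k \<le> v"
    using nth_position[OF v] by (auto simp: nonmin_positions_iff not_less)
  moreover have "\<pi> ! k \<noteq> v"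
    using k(1) position_nth[OF assms(1), of k] position_less[OF v] by auto
  ultimately show ?thesis by force
qed

lemma nonmin_value_exceeds_some:
  assumes "distinct \<pi>" and "v \<in> nonmin_values \<pi>"
  shows "\<exists>j<length \<pi>. \<pi> ! j < v"
proof -
  obtain j where j: "j < position \<pi> v" "\<pi> ! j < v"
    using nonmin_value_has_smaller[OF assms] by blast
  moreover have "position \<pi> v < length \<pi>"
    using assms(2) by (intro position_less) (simp add: nonmin_values_def)
  ultimately show ?thesis by (intro exI[of _ j]) simp
qed

lemma first_below_less_position:
  assumes "distinct \<pi>" and "v \<in> nonmin_values \<pi>"
  shows "first_below \<pi> v < position \<pi> v"
proof -
  obtain j where j: "j < position \<pi> v" "\<pi> ! j < v"
    using nonmin_value_has_smaller[OF assms] by blast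
  moreover have "position \<pi> v < length \<pi>"
    using assms(2) by (intro position_less) (simp add: nonmin_values_def)
  ultimately show ?thesis using first_below_le[of j \<pi> v] by simp
qed

lemma first_below_cong:
  assumes eq: "lr_minima \<pi> = lr_minima \<rho>" and "length \<pi> = length \<rho>"
    and ex: "\<exists>j<length \<pi>. \<pi> ! j < v"
  shows "first_below \<pi> v = first_below \<rho> v"
proof (rule antisym)
  have "(Suc (first_below \<pi> v), \<pi> ! first_below \<pi> v) \<in> lr_minima \<rho>"
    using first_below(3)[OF ex] eq by simp
  then have *: "first_below \<pi> v < length \<rho>" "\<rho> ! first_below \<pi> v < v"
    using first_below(2)[OF ex] by (auto simp: lr_minima_iff)
  then show "first_below \<rho> v \<le> first_below \<pi> v" by (rule first_below_le)
  have ex': "\<exists>j<length \<rho>. \<rho> ! j < v" using * by blast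
  have "(Suc (first_below \<rho> v), \<rho> ! first_below \<rho> v) \<in> lr_minima \<pi>"
    using first_below(3)[OF ex'] eq by simp
  then have *: "first_below \<rho> v < length \<pi>" "\<pi> ! first_below \<rho> v < v"
    using first_below(2)[OF ex'] by (auto simp: lr_minima_iff)
  then show "first_below \<pi> v \<le> first_below \<rho> v" by (rule first_below_le)
qed

text \<open>
  A value that comes after a smaller minimum of \<open>\<rho>\<close> is not a left-right minimum. Conversely no such
  value can spoil a minimum \<open>m\<close> of \<open>\<rho>\<close>: standing before \<open>m\<close>, it also follows a minimum that lies
  before \<open>m\<close> and is smaller than itself, and that minimum exceeds \<open>m\<close>.
\<close>

lemma lr_minima_eqI:
  assumes dist: "distinct \<pi>" "distinct \<rho>" and "set \<pi> = set \<rho>"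
    and min: "\<And>j v. (Suc j, v) \<in> lr_minima \<rho> \<Longrightarrow> \<pi> ! j = v"
    and nonmin: "\<And>v. v \<in> nonmin_values \<rho> \<Longrightarrow> first_below \<rho> v < position \<pi> v"
  shows "lr_minima \<pi> = lr_minima \<rho>"
proof -
  have len: "length \<pi> = length \<rho>" using assms(1-3) by (metis distinct_card)
  have minval: "(Suc j, \<pi> ! j) \<in> lr_minima \<rho>" if "j < length \<pi>" "\<pi> ! j \<notin> nonmin_values \<rho>" for j
  proof -
    have "\<pi> ! j \<in> snd ` lr_minima \<rho>"
      using that assms(3) nth_mem[of j \<pi>] by (auto simp: nonmin_values_def)
    then obtain k where k: "(Suc k, \<pi> ! j) \<in> lr_minima \<rho>"
      unfolding lr_minima_def by auto
    then have "k < length \<pi>" using len by (simp add: lr_minima_iff)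
    then have "k = j" using min[OF k] that dist(1) by (simp add: nth_eq_iff_index_eq)
    then show ?thesis using k by simp
  qed
  have below: "\<exists>p<j. p < length \<rho> \<and> \<rho> ! p < \<pi> ! j \<and> \<pi> ! p = \<rho> ! p" 
    if "j < length \<pi>" "\<pi> ! j \<in> nonmin_values \<rho>" for j
    using nonmin[OF that(2)] first_below[OF nonmin_value_exceeds_some[OF dist(2) that(2)]]
      min position_nth[OF dist(1) that(1)] by metis
  show ?thesis
  proof (intro equalityI subsetI)
    fix x assume "x \<in> lr_minima \<pi>"
    then obtain j where j: "x = (Suc j, \<pi> ! j)" "j < length \<pi>" "\<forall>k<j. \<pi> ! j < \<pi> ! k"
      unfolding lr_minima_def by auto
    have "\<pi> ! j \<notin> nonmin_values \<rho>" using below[OF j(2)] j(3) by (metis less_asym)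
    then show "x \<in> lr_minima \<rho>" using minval j by simp
  next
    fix x assume x: "x \<in> lr_minima \<rho>"
    then obtain j where j: "x = (Suc j, \<rho> ! j)" "j < length \<rho>" "\<forall>k<j. \<rho> ! j < \<rho> ! k"
      unfolding lr_minima_def by auto
    have "\<rho> ! j < \<pi> ! k" if "k < j" for k
    proof (cases "\<pi> ! k \<in> nonmin_values \<rho>")
      case True
      then show ?thesis using below[of k] j that len by (metis less_trans)
    next
      case False
      then have "\<pi> ! k = \<rho> ! k" using minval[of k] that j(2) len by (simp add: lr_minima_iff)
      then show ?thesis using j(3) that by simp
    qed
    moreover have "\<pi> ! j = \<rho> ! j" using min x j(1) by simp
    ultimately show "x \<in> lr_minima \<pi>" using j len by (simp add: lr_minima_iff)
  qed
qed

text \<open>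
  The free positions for \<open>v\<close> are those finally taken by the entries \<open>\<ge> v\<close> that come after the
  first smaller entry; no minimum is among them, since they all follow an entry below \<open>v\<close>.
\<close>

lemma free_positions_eq:
  assumes "distinct \<pi>" and v: "v \<in> nonmin_values \<pi>"
  shows "{q \<in> nonmin_positions \<pi>. first_below \<pi> v < q \<and>
            q \<notin> position \<pi> ` {w \<in> nonmin_values \<pi>. w < v}} =
         {q. q < length \<pi> \<and> first_below \<pi> v < q \<and> v \<le> \<pi> ! q}" (is "?A = ?B")
proof (intro equalityI subsetI)
  fix q assume q: "q \<in> ?A"
  then have "q < length \<pi>" by (simp add: nonmin_positions_iff)
  moreover from this have "\<pi> ! q \<in> nonmin_values \<pi>"
    using q nonmin_values_iff[OF assms(1)] position_nth[OF assms(1)] by auto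
  ultimately show "q \<in> ?B" using q position_nth[OF assms(1), of q] by (force simp: not_le[symmetric])
next
  fix q assume q: "q \<in> ?B"
  have "\<pi> ! first_below \<pi> v < \<pi> ! q"
    using first_below(2)[OF nonmin_value_exceeds_some[OF assms]] q by auto
  then have "q \<in> nonmin_positions \<pi>" using q by (force simp: nonmin_positions_iff)
  moreover have "q \<notin> position \<pi> ` {w \<in> nonmin_values \<pi>. w < v}"
    using q nth_position by (auto simp: nonmin_values_def)
  ultimately show "q \<in> ?A" using q by simp
qed

lemma card_less_2_iff:
  fixes A :: "'a::linorder set"
  assumes "finite A"
  shows "card A < 2 \<longleftrightarrow> \<not> (\<exists>x y. x \<in> A \<and> y \<in> A \<and> x < y)"
proof -
  have "card A < 2 \<longleftrightarrow> card A \<le> Suc 0" by auto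
  also have "\<dots> \<longleftrightarrow> (\<forall>x\<in>A. \<forall>y\<in>A. x = y)" by (rule card_le_Suc0_iff_eq[OF assms])
  also have "\<dots> \<longleftrightarrow> \<not> (\<exists>x y. x \<in> A \<and> y \<in> A \<and> x < y)"
    by (metis less_irrefl linorder_less_linear)
  finally show ?thesis .
qed

lemma position_in_first_two_iff:
  assumes "distinct \<pi>" and v: "v \<in> nonmin_values \<pi>"
  shows "position \<pi> v \<in> first_two {q \<in> nonmin_positions \<pi>. first_below \<pi> v < q \<and>
            q \<notin> position \<pi> ` {w \<in> nonmin_values \<pi>. w < v}} \<longleftrightarrow>
    \<not> (\<exists>x y. first_below \<pi> v < x \<and> x < y \<and> y < position \<pi> v \<and> v < \<pi> ! x \<and> v < \<pi> ! y)"
proof -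
  have vs: "v \<in> set \<pi>" using v by (simp add: nonmin_values_def)
  note p = position_less[OF vs] nth_position[OF vs] first_below_less_position[OF assms]
  let ?F = "{q. q < length \<pi> \<and> first_below \<pi> v < q \<and> v \<le> \<pi> ! q}"
  have "v \<noteq> \<pi> ! x" if "x < position \<pi> v" for x
    using that position_nth[OF assms(1), of x] p(1) by auto
  then have F: "{x \<in> ?F. x < position \<pi> v} =
      {x. first_below \<pi> v < x \<and> x < position \<pi> v \<and> v < \<pi> ! x}"
    using p(1) by (auto simp: less_le)
  have "position \<pi> v \<in> ?F" using p by simp
  then have "position \<pi> v \<in> first_two ?F \<longleftrightarrow>
      card {x. first_below \<pi> v < x \<and> x < position \<pi> v \<and> v < \<pi> ! x} < 2"
    unfolding first_two_def F[symmetric] by simp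
  also have "\<dots> \<longleftrightarrow>
    \<not> (\<exists>x y. first_below \<pi> v < x \<and> x < y \<and> y < position \<pi> v \<and> v < \<pi> ! x \<and> v < \<pi> ! y)"
    by (subst card_less_2_iff, simp, intro arg_cong[where f = Not] ex_cong1) auto
  finally show ?thesis by (simp only: free_positions_eq[OF assms])
qed

lemma position_in_last_two_iff:
  assumes "distinct \<pi>" and v: "v \<in> nonmin_values \<pi>"
  shows "position \<pi> v \<in> last_two {q \<in> nonmin_positions \<pi>. first_below \<pi> v < q \<and>
            q \<notin> position \<pi> ` {w \<in> nonmin_values \<pi>. w < v}} \<longleftrightarrow>
    \<not> (\<exists>x y. position \<pi> v < x \<and> x < y \<and> y < length \<pi> \<and> v < \<pi> ! x \<and> v < \<pi> ! y)"
proof -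
  have vs: "v \<in> set \<pi>" using v by (simp add: nonmin_values_def)
  note p = position_less[OF vs] nth_position[OF vs] first_below_less_position[OF assms]
  let ?F = "{q. q < length \<pi> \<and> first_below \<pi> v < q \<and> v \<le> \<pi> ! q}"
  have "v \<noteq> \<pi> ! x" if "position \<pi> v < x" "x < length \<pi>" for x
    using that position_nth[OF assms(1), of x] by auto
  then have F: "{x \<in> ?F. position \<pi> v < x} = {x. position \<pi> v < x \<and> x < length \<pi> \<and> v < \<pi> ! x}"
    using p(3) by (auto simp: less_le)
  have "position \<pi> v \<in> ?F" using p by simp
  then have "position \<pi> v \<in> last_two ?F \<longleftrightarrow>
      card {x. position \<pi> v < x \<and> x < length \<pi> \<and> v < \<pi> ! x} < 2"
    unfolding last_two_def F[symmetric] by simp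
  also have "\<dots> \<longleftrightarrow>
    \<not> (\<exists>x y. position \<pi> v < x \<and> x < y \<and> y < length \<pi> \<and> v < \<pi> ! x \<and> v < \<pi> ! y)"
    by (subst card_less_2_iff, simp, intro arg_cong[where f = Not] ex_cong1) auto
  finally show ?thesis by (simp only: free_positions_eq[OF assms])
qed

lemma nth_in_nonmin_values:
  assumes "distinct \<pi>" and "a < b" "b < length \<pi>" "\<pi> ! a < \<pi> ! b"
  shows "\<pi> ! b \<in> nonmin_values \<pi>"
proof -
  have "\<not> (\<forall>k<b. \<pi> ! b < \<pi> ! k)" using assms(2,4) by (meson less_asym)
  then show ?thesis
    using nonmin_values_iff[OF assms(1)] position_nth[OF assms(1,3)] assms(3)
    by (simp add: nonmin_positions_iff)
qed

text \<open>
  An occurrence \<open>a, b, c, d\<close> is moved to a canonical one: \<open>d\<close> holds the value \<open>v\<close>, and the entry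
  at \<open>a\<close> is replaced by the first entry smaller than \<open>v\<close>, which can only enlarge the gap.
\<close>

lemma avoids_1342_1432_iff_first_two:
  assumes "distinct \<pi>"
  shows "avoids \<pi> [1,3,4,2] \<and> avoids \<pi> [1,4,3,2] \<longleftrightarrow>
    (\<forall>v \<in> nonmin_values \<pi>. position \<pi> v \<in>
       first_two {q \<in> nonmin_positions \<pi>. first_below \<pi> v < q \<and>
                  q \<notin> position \<pi> ` {w \<in> nonmin_values \<pi>. w < v}})"
proof -
  have "(\<exists>a b c d. a < b \<and> b < c \<and> c < d \<and> d < length \<pi> \<and>
           \<pi> ! a < \<pi> ! d \<and> \<pi> ! d < \<pi> ! b \<and> \<pi> ! d < \<pi> ! c) \<longleftrightarrow>
    (\<exists>v\<in>nonmin_values \<pi>. \<exists>x y. first_below \<pi> v < x \<and> x < y \<and> y < position \<pi> v \<and>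
           v < \<pi> ! x \<and> v < \<pi> ! y)" (is "?l \<longleftrightarrow> ?r")
  proof
    assume ?l
    then obtain a b c d where *: "a < b" "b < c" "c < d" "d < length \<pi>" "\<pi> ! a < \<pi> ! d"
      "\<pi> ! d < \<pi> ! b" "\<pi> ! d < \<pi> ! c" by blast
    have "\<pi> ! d \<in> nonmin_values \<pi>" using nth_in_nonmin_values[OF assms, of a d] * by simp
    moreover have "first_below \<pi> (\<pi> ! d) < b" using first_below_le[of a \<pi> "\<pi> ! d"] * by simp
    moreover have "c < position \<pi> (\<pi> ! d)" using position_nth[OF assms, of d] * by simp
    ultimately show ?r using * by blast
  next
    assume ?r
    then obtain v x y where v: "v \<in> nonmin_values \<pi>"
      and *: "first_below \<pi> v < x" "x < y" "y < position \<pi> v" "v < \<pi> ! x" "v < \<pi> ! y" by blast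
    have vs: "v \<in> set \<pi>" using v by (simp add: nonmin_values_def)
    show ?l
      by (rule exI[of _ "first_below \<pi> v"], rule exI[of _ x], rule exI[of _ y],
          rule exI[of _ "position \<pi> v"])
        (use * first_below(2)[OF nonmin_value_exceeds_some[OF assms v]]
          position_less[OF vs] nth_position[OF vs] in simp)
  qed
  then show ?thesis
    unfolding avoids_1342_1432_iff[OF assms] using position_in_first_two_iff[OF assms] by simp
qed

text \<open>
  Here \<open>b\<close> holds the value \<open>v\<close>; the entry at \<open>a\<close> only witnesses that \<open>v\<close> is not a left-right
  minimum.
\<close>

lemma avoids_1234_1243_iff_last_two:
  assumes "distinct \<pi>"
  shows "avoids \<pi> [1,2,3,4] \<and> avoids \<pi> [1,2,4,3] \<longleftrightarrow>
    (\<forall>v \<in> nonmin_values \<pi>. position \<pi> v \<in>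
       last_two {q \<in> nonmin_positions \<pi>. first_below \<pi> v < q \<and>
                 q \<notin> position \<pi> ` {w \<in> nonmin_values \<pi>. w < v}})"
proof -
  have "(\<exists>a b c d. a < b \<and> b < c \<and> c < d \<and> d < length \<pi> \<and>
           \<pi> ! a < \<pi> ! b \<and> \<pi> ! b < \<pi> ! c \<and> \<pi> ! b < \<pi> ! d) \<longleftrightarrow>
    (\<exists>v\<in>nonmin_values \<pi>. \<exists>x y. position \<pi> v < x \<and> x < y \<and> y < length \<pi> \<and>
           v < \<pi> ! x \<and> v < \<pi> ! y)" (is "?l \<longleftrightarrow> ?r")
  proof
    assume ?l
    then obtain a b c d where *: "a < b" "b < c" "c < d" "d < length \<pi>" "\<pi> ! a < \<pi> ! b"
      "\<pi> ! b < \<pi> ! c" "\<pi> ! b < \<pi> ! d" by blast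
    have "\<pi> ! b \<in> nonmin_values \<pi>" using nth_in_nonmin_values[OF assms, of a b] * by simp
    moreover have "position \<pi> (\<pi> ! b) < c" using position_nth[OF assms, of b] * by simp
    ultimately show ?r using * by blast
  next
    assume ?r
    then obtain v x y where v: "v \<in> nonmin_values \<pi>"
      and *: "position \<pi> v < x" "x < y" "y < length \<pi>" "v < \<pi> ! x" "v < \<pi> ! y" by blast
    have vs: "v \<in> set \<pi>" using v by (simp add: nonmin_values_def)
    show ?l
      by (rule exI[of _ "first_below \<pi> v"], rule exI[of _ "position \<pi> v"], rule exI[of _ x],
          rule exI[of _ y])
        (use * first_below(2)[OF nonmin_value_exceeds_some[OF assms v]]
          first_below_less_position[OF assms v] nth_position[OF vs] in simp)
  qed
  then show ?thesis
    unfolding avoids_1234_1243_iff[OF assms] using position_in_last_two_iff[OF assms] by simp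
qed

section \<open>Permutations with prescribed left-right minima\<close>

lemma nonmin_cong:
  assumes "lr_minima \<pi> = lr_minima \<rho>" and "set \<pi> = set \<rho>" and "length \<pi> = length \<rho>"
  shows "nonmin_values \<pi> = nonmin_values \<rho>" and "nonmin_positions \<pi> = nonmin_positions \<rho>"
  using assms by (simp_all add: nonmin_values_def nonmin_positions_def)

text \<open>
  A permutation with the left-right minima of \<open>\<rho>\<close> is determined by the positions of the other
  values, and by \<open>lr_minima_eqI\<close> these positions are only constrained to lie after the first
  smaller minimum. The permutation \<open>\<rho>\<close> serves as a representative of the prescribed set of
  minima.
\<close>

lemma bij_betw_placements:
  assumes \<rho>: "distinct \<rho>" and C: "\<And>S. C S \<subseteq> S"
  shows "bij_betw (\<lambda>\<pi>. restrict (position \<pi>) (nonmin_values \<rho>))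
    {\<pi> \<in> permutations_of_set (set \<rho>). lr_minima \<pi> = lr_minima \<rho> \<and>
       (\<forall>v \<in> nonmin_values \<pi>. position \<pi> v \<in>
          C {q \<in> nonmin_positions \<pi>. first_below \<pi> v < q \<and>
             q \<notin> position \<pi> ` {w \<in> nonmin_values \<pi>. w < v}})}
    (placements C (first_below \<rho>) (nonmin_positions \<rho>) (nonmin_values \<rho>))"
    (is "bij_betw ?f ?X ?Y")
proof -
  let ?R = "nonmin_values \<rho>" and ?Q = "nonmin_positions \<rho>" and ?n = "length \<rho>"
  have perm: "distinct \<pi>" "set \<pi> = set \<rho>" "length \<pi> = ?n" if "\<pi> \<in> permutations_of_set (set \<rho>)" for \<pi>
    using that \<rho> by (auto simp: permutations_of_set_def distinct_card dest: distinct_card)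
  have sub: "?R \<subseteq> set \<rho>" by (auto simp: nonmin_values_def)
  have fb: "first_below \<pi> v = first_below \<rho> v"
    if "\<pi> \<in> permutations_of_set (set \<rho>)" "lr_minima \<pi> = lr_minima \<rho>" "v \<in> ?R" for \<pi> v
    using first_below_cong[of \<rho> \<pi> v] nonmin_value_exceeds_some[OF \<rho> that(3)] perm[OF that(1)] that(2)
    by simp
  have X_iff: "\<pi> \<in> ?X \<longleftrightarrow> \<pi> \<in> permutations_of_set (set \<rho>) \<and> lr_minima \<pi> = lr_minima \<rho> \<and> ?f \<pi> \<in> ?Y" for \<pi>
  proof (cases "\<pi> \<in> permutations_of_set (set \<rho>) \<and> lr_minima \<pi> = lr_minima \<rho>")
    case True
    have im: "?f \<pi> ` {w \<in> ?R. w < v} = position \<pi> ` {w \<in> ?R. w < v}" for v by auto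
    have RQ: "nonmin_values \<pi> = ?R" "nonmin_positions \<pi> = ?Q"
      using True perm nonmin_cong[of \<pi> \<rho>] by auto
    have "\<pi> \<in> ?X \<longleftrightarrow> (\<forall>v \<in> ?R. position \<pi> v \<in>
          C {q \<in> ?Q. first_below \<pi> v < q \<and> q \<notin> position \<pi> ` {w \<in> ?R. w < v}})"
      using True RQ by simp
    also have "\<dots> \<longleftrightarrow> (\<forall>v \<in> ?R. position \<pi> v \<in>
          C {q \<in> ?Q. first_below \<rho> v < q \<and> q \<notin> position \<pi> ` {w \<in> ?R. w < v}})"
      using True fb by (intro ball_cong) simp_all
    also have "\<dots> \<longleftrightarrow> ?f \<pi> \<in> ?Y" unfolding placements_def im by simp
    finally show ?thesis using True by simp
  qed auto
  show ?thesis
  proof (rule bij_betw_imageI)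
    show "inj_on ?f ?X"
    proof (rule inj_onI)
      fix \<pi> \<sigma> assume "\<pi> \<in> ?X" "\<sigma> \<in> ?X" and eq: "?f \<pi> = ?f \<sigma>"
      then have \<pi>: "\<pi> \<in> permutations_of_set (set \<rho>)" "lr_minima \<pi> = lr_minima \<rho>"
        and \<sigma>: "\<sigma> \<in> permutations_of_set (set \<rho>)" "lr_minima \<sigma> = lr_minima \<rho>" by auto
      show "\<pi> = \<sigma>"
      proof (rule nth_equalityI)
        show "length \<pi> = length \<sigma>" using perm[OF \<pi>(1)] perm[OF \<sigma>(1)] by simp
        fix j assume j: "j < length \<pi>"
        show "\<pi> ! j = \<sigma> ! j"
        proof (cases "\<pi> ! j \<in> ?R")
          case True
          then have "position \<sigma> (\<pi> ! j) = j"
            using fun_cong[OF eq, of "\<pi> ! j"] position_nth[OF perm(1)[OF \<pi>(1)] j] by simp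
          then show ?thesis using nth_position[of "\<pi> ! j" \<sigma>] perm[OF \<sigma>(1)] sub True by auto
        next
          case False
          then have "j \<notin> nonmin_positions \<pi>"
            using nonmin_values_iff[OF perm(1)[OF \<pi>(1)], of "\<pi> ! j"] j \<pi>
              nonmin_cong[of \<pi> \<rho>] perm[OF \<pi>(1)] position_nth[of \<pi> j] by auto
          then have "(Suc j, \<pi> ! j) \<in> lr_minima \<sigma>"
            using j \<pi> \<sigma> by (metis lr_minima_iff nonmin_positions_iff)
          then show ?thesis by (simp add: lr_minima_iff)
        qed
      qed
    qed
    show "?f ` ?X = ?Y"
    proof (intro equalityI subsetI)
      fix g assume "g \<in> ?f ` ?X" then show "g \<in> ?Y" using X_iff by blast
    next
      fix g assume g: "g \<in> ?Y"
      have gQ: "g ` ?R \<subseteq> ?Q" using placements_range(1)[OF C g] by auto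
      have "finite ?R" "finite ?Q" using sub finite_subset by (auto simp: nonmin_positions_def)
      moreover have "card ?R = card ?Q"
        using bij_betw_position_nonmin[OF \<rho>] by (rule bij_betw_same_card)
      ultimately have g_bij: "bij_betw g ?R ?Q"
        using placements_inj_on[OF C g] gQ by (metis bij_betw_def card_image card_subset_eq)
      \<comment> \<open>Keep the minima of \<open>\<rho>\<close> in place and distribute the other values according to \<open>g\<close>; the
        permutation sought is the inverse of \<open>h\<close>.\<close>
      define h where "h v = (if v \<in> ?R then g v else position \<rho> v)" for v
      have "bij_betw h ?R ?Q" using g_bij by (simp add: h_def bij_betw_def inj_on_def image_def)
      moreover have "bij_betw h (set \<rho> - ?R) ({..<?n} - ?Q)"
      proof -
        have "bij_betw (position \<rho>) (set \<rho> - ?R) ({..<?n} - ?Q)"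
          using bij_betw_position[OF \<rho>] bij_betw_position_nonmin[OF \<rho>] sub
          by (simp add: bij_betw_def inj_on_diff inj_on_image_set_diff[of _ "set \<rho>"])
        then show ?thesis by (rule bij_betw_cong[THEN iffD1, rotated]) (simp add: h_def)
      qed
      moreover have "?R \<union> (set \<rho> - ?R) = set \<rho>" "?Q \<union> ({..<?n} - ?Q) = {..<?n}"
        using sub by (auto simp: nonmin_positions_def)
      ultimately have h: "bij_betw h (set \<rho>) {..<?n}"
        by (metis Diff_disjoint bij_betw_combine)
      define \<pi> where "\<pi> = map (inv_into (set \<rho>) h) [0..<?n]"
      have len: "length \<pi> = ?n" by (simp add: \<pi>_def)
      have inv: "bij_betw (inv_into (set \<rho>) h) {..<?n} (set \<rho>)" using h by (rule bij_betw_inv_into)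
      have "set \<pi> = set \<rho>" using inv by (simp add: \<pi>_def bij_betw_def lessThan_atLeast0)
      moreover have "distinct \<pi>" using inv by (simp add: \<pi>_def distinct_map bij_betw_def lessThan_atLeast0)
      ultimately have \<pi>: "\<pi> \<in> permutations_of_set (set \<rho>)" by (simp add: permutations_of_set_def)
      have nth_h: "\<pi> ! h v = v" if "v \<in> set \<rho>" for v
        using that h by (simp add: \<pi>_def bij_betw_def bij_betwE[OF h] inv_into_f_f) (use bij_betwE[OF h] in auto)
      have pos: "position \<pi> v = h v" if "v \<in> set \<rho>" for v
        using position_nth[OF \<open>distinct \<pi>\<close>, of "h v"] nth_h[OF that] bij_betwE[OF h] that len by auto
      have fg: "?f \<pi> = g"
      proof
        fix v show "?f \<pi> v = g v"
          using g pos sub by (cases "v \<in> ?R") (auto simp: h_def placements_def extensional_def)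
      qed
      have "lr_minima \<pi> = lr_minima \<rho>"
      proof (rule lr_minima_eqI[OF \<open>distinct \<pi>\<close> \<rho> \<open>set \<pi> = set \<rho>\<close>])
        fix j v assume jv: "(Suc j, v) \<in> lr_minima \<rho>"
        then have "j < ?n" "v = \<rho> ! j" by (simp_all add: lr_minima_iff)
        moreover from this have "v \<in> set \<rho>" "position \<rho> v = j"
          using position_nth[OF \<rho>, of j] by simp_all
        moreover have "v \<notin> ?R" using jv by (force simp: nonmin_values_def)
        ultimately show "\<pi> ! j = v" using nth_h[of v] by (simp add: h_def)
      next
        fix v assume v: "v \<in> ?R"
        then show "first_below \<rho> v < position \<pi> v"
          using placements_range(2)[OF C g v] pos sub by (auto simp: h_def)
      qed
      then have "\<pi> \<in> ?X" using X_iff \<pi> fg g by blast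
      then show "g \<in> ?f ` ?X" using fg by blast
    qed
  qed
qed

lemma card_avoiders_given_lr_minima:
  fixes n i :: nat and M
  defines "A \<equiv> {\<pi> \<in> avoiders n i [1,3,4,2] [1,4,3,2]. lr_minima \<pi> = M}"
    and "B \<equiv> {\<pi> \<in> avoiders n i [1,2,3,4] [1,2,4,3]. lr_minima \<pi> = M}"
  assumes "1 \<le> n"
  shows "card A = card B"
proof (cases "A = {} \<and> B = {}")
  case False
  then obtain \<rho> where \<rho>: "\<rho> \<in> permutations_of_set {1..n}" "\<rho> ! 0 = i" "lr_minima \<rho> = M"
    by (auto simp: A_def B_def avoiders_def)
  have d: "distinct \<rho>" "set \<rho> = {1..n}" using \<rho> by (auto simp: permutations_of_set_def)
  have first: "(Suc 0, \<pi> ! 0) \<in> lr_minima \<pi>" if "\<pi> \<in> permutations_of_set {1..n}" for \<pi>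
    using that assms(3) distinct_card[of \<pi>] by (auto simp: permutations_of_set_def lr_minima_iff)
  \<comment> \<open>The first entry is a left-right minimum, so \<open>M\<close> prescribes it.\<close>
  have head: "\<pi> ! 0 = i" if "\<pi> \<in> permutations_of_set {1..n}" "lr_minima \<pi> = M" for \<pi>
  proof -
    have "(Suc 0, i) \<in> lr_minima \<pi>" using first[OF \<rho>(1)] \<rho> that by simp
    then show ?thesis by (simp add: lr_minima_iff)
  qed
  let ?P = "\<lambda>C. placements C (first_below \<rho>) (nonmin_positions \<rho>) (nonmin_values \<rho>)"
  let ?X = "\<lambda>C. {\<pi> \<in> permutations_of_set (set \<rho>). lr_minima \<pi> = lr_minima \<rho> \<and>
       (\<forall>v \<in> nonmin_values \<pi>. position \<pi> v \<in>
          C {q \<in> nonmin_positions \<pi>. first_below \<pi> v < q \<and>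
             q \<notin> position \<pi> ` {w \<in> nonmin_values \<pi>. w < v}})}"
  have XP: "card (?X C) = card (?P C)" if "\<And>S. C S \<subseteq> S" for C
    using bij_betw_same_card[OF bij_betw_placements[OF d(1) that]] by simp
  have "A = ?X first_two"
    using head \<rho>(3) d(2) avoids_1342_1432_iff_first_two
    by (auto simp: A_def avoiders_def dest: permutations_of_setD)
  moreover have "B = ?X last_two"
    using head \<rho>(3) d(2) avoids_1234_1243_iff_last_two
    by (auto simp: B_def avoiders_def dest: permutations_of_setD)
  moreover have "card (?P first_two) = card (?P last_two)"
  proof (rule card_placements_first_two_eq_last_two)
    show "finite (nonmin_positions \<rho>)" "finite (nonmin_values \<rho>)"
      by (auto simp: nonmin_positions_def nonmin_values_def)
    fix v w assume "v \<in> nonmin_values \<rho>" "v \<le> w"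
    then show "first_below \<rho> w \<le> first_below \<rho> v"
      using first_below[OF nonmin_value_exceeds_some[OF d(1)], of v]
      by (intro first_below_le) auto
  qed
  ultimately show ?thesis using XP[of first_two] XP[of last_two]
    by (auto simp: first_two_def last_two_def)
qed simp

section \<open>Counting by the first entry\<close>

text \<open>
  Avoidance of 1234 and 1243 in recursive form, with \<open>m\<close> the minimum of the entries already read:
  an entry that exceeds \<open>m\<close> is followed by at most one larger entry.
\<close>

fun few_above :: "nat \<Rightarrow> nat list \<Rightarrow> bool" where
  "few_above m [] \<longleftrightarrow> True"
| "few_above m (x # xs) \<longleftrightarrow>
     (m < x \<longrightarrow> \<not> (\<exists>c d. c < d \<and> d < length xs \<and> x < xs ! c \<and> x < xs ! d)) \<and>
     few_above (min m x) xs"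

lemma few_above_Cons_less: "x < m \<Longrightarrow> few_above m (x # xs) \<longleftrightarrow> few_above x xs"
  by (simp add: min_def)

lemma few_above_Cons_greater:
  "m < x \<Longrightarrow> few_above m (x # xs) \<longleftrightarrow>
     \<not> (\<exists>c d. c < d \<and> d < length xs \<and> x < xs ! c \<and> x < xs ! d) \<and> few_above m xs"
  by (simp add: min_def)

text \<open>
  Separates the triples of positions in a list \<open>x # xs\<close> that involve the head.
\<close>

lemma ex3_less_Suc:
  "(\<exists>b c d. b < c \<and> c < d \<and> d < Suc n \<and> P b c d) \<longleftrightarrow>
     (\<exists>c d. c < d \<and> d < n \<and> P 0 (Suc c) (Suc d)) \<or>
     (\<exists>b c d. b < c \<and> c < d \<and> d < n \<and> P (Suc b) (Suc c) (Suc d))" (is "?L \<longleftrightarrow> ?R1 \<or> ?R2")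
proof
  assume ?L
  then obtain b c d where *: "b < c" "c < d" "d < Suc n" "P b c d" by blast
  obtain c' d' where cd: "c = Suc c'" "d = Suc d'" using * by (metis less_imp_Suc_add)
  show "?R1 \<or> ?R2" using * cd by (cases b) auto
next
  assume "?R1 \<or> ?R2"
  then show ?L by (metis Suc_less_eq zero_less_Suc)
qed

lemma few_above_iff:
  "few_above m xs \<longleftrightarrow>
    \<not> (\<exists>b c d. b < c \<and> c < d \<and> d < length xs \<and> (m < xs ! b \<or> (\<exists>a<b. xs ! a < xs ! b)) \<and>
        xs ! b < xs ! c \<and> xs ! b < xs ! d)"
proof (induction m xs rule: few_above.induct)
  case (2 m x xs)
  show ?case
    unfolding few_above.simps 2 length_Cons
    by (subst ex3_less_Suc) (auto simp: Ex_less_Suc2 min_less_iff_disj)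
qed simp

lemma avoids_1234_1243_Cons_iff:
  assumes "distinct (k # xs)"
  shows "avoids (k # xs) [1,2,3,4] \<and> avoids (k # xs) [1,2,4,3] \<longleftrightarrow> few_above k xs"
proof -
  have smaller_before: "(\<exists>a b c d. a < b \<and> b < c \<and> c < d \<and> d < length \<pi> \<and>
         \<pi> ! a < \<pi> ! b \<and> \<pi> ! b < \<pi> ! c \<and> \<pi> ! b < \<pi> ! d) \<longleftrightarrow>
    (\<exists>b c d. b < c \<and> c < d \<and> d < length \<pi> \<and> (\<exists>a<b. \<pi> ! a < \<pi> ! b) \<and>
         \<pi> ! b < \<pi> ! c \<and> \<pi> ! b < \<pi> ! d)" for \<pi> :: "nat list" by blast
  show ?thesis
    unfolding avoids_1234_1243_iff[OF assms] few_above_iff[of k xs] smaller_before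
    unfolding length_Cons
    by (subst ex3_less_Suc) (auto simp: Ex_less_Suc2)
qed

text \<open>
  The relabelling that makes room for a new entry of value \<open>t\<close>.
\<close>

definition lift :: "nat \<Rightarrow> nat \<Rightarrow> nat" where
  "lift t x = (if x < t then x else Suc x)"

lemma lift_less_iff [simp]: "lift t x < lift t y \<longleftrightarrow> x < y"
  by (auto simp: lift_def)

lemma inj_lift: "inj (lift t)"
  by (auto simp: inj_def lift_def split: if_splits)

lemma lift_min: "lift t (min x y) = min (lift t x) (lift t y)"
  by (auto simp: min_def lift_def)

lemma few_above_lift: "few_above (lift t m) (map (lift t) xs) \<longleftrightarrow> few_above m xs"
proof (induction m xs rule: few_above.induct)
  case (2 m x xs)
  have "(\<exists>c d. c < d \<and> d < length xs \<and> lift t x < map (lift t) xs ! c \<and> lift t x < map (lift t) xs ! d)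
    \<longleftrightarrow> (\<exists>c d. c < d \<and> d < length xs \<and> x < xs ! c \<and> x < xs ! d)"
    by (intro arg_cong[of _ _ Ex] ext) auto
  then show ?case using 2 by (simp add: lift_min[symmetric])
qed simp

lemma image_lift: "t \<in> {1..Suc m} \<Longrightarrow> lift t ` {1..m} = {1..Suc m} - {t}"
proof (intro equalityI subsetI)
  fix y assume "t \<in> {1..Suc m}" "y \<in> {1..Suc m} - {t}"
  then show "y \<in> lift t ` {1..m}"
    by (intro image_eqI[of _ _ "if y < t then y else y - 1"]) (auto simp: lift_def)
qed (auto simp: lift_def split: if_splits)

lemma Cons_lift_permutation_iff:
  assumes "t \<in> {1..Suc m}"
  shows "t # map (lift t) xs \<in> permutations_of_set {1..Suc m} \<longleftrightarrow> xs \<in> permutations_of_set {1..m}"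
proof -
  have "insert t (lift t ` set xs) = {1..Suc m} \<and> t \<notin> lift t ` set xs \<longleftrightarrow>
      lift t ` set xs = lift t ` {1..m}"
    unfolding image_lift[OF assms] using assms by blast
  also have "\<dots> \<longleftrightarrow> set xs = {1..m}" by (rule inj_image_eq_iff[OF inj_lift])
  finally show ?thesis
    using inj_on_subset[OF inj_lift] by (auto simp: permutations_of_set_def distinct_map)
qed

lemma permutation_ConsE:
  assumes "t # ys \<in> permutations_of_set {1..Suc m}"
  obtains xs where "ys = map (lift t) xs" "xs \<in> permutations_of_set {1..m}" "t \<in> {1..Suc m}"
proof -
  have t: "t \<in> {1..Suc m}" using assms by (auto simp: permutations_of_set_def)
  have "set ys = {1..Suc m} - {t}" using assms by (auto simp: permutations_of_set_def)
  then have "set ys \<subseteq> range (lift t)" using image_lift[OF t] by auto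
  then obtain xs where "ys = map (lift t) xs" by (metis ex_map_conv rangeE subsetD)
  then show thesis using that Cons_lift_permutation_iff[OF t] assms t by blast
qed

text \<open>
  The avoiders with first entry \<open>k\<close>, stored without that entry.
\<close>

definition tails :: "nat \<Rightarrow> nat \<Rightarrow> nat list set" where
  "tails n k = {xs. k # xs \<in> permutations_of_set {1..n} \<and> few_above k xs}"

lemma finite_tails: "finite (tails n k)"
proof -
  have "tails n k \<subseteq> tl ` permutations_of_set {1..n}" by (force simp: tails_def)
  then show ?thesis by (rule finite_subset) simp
qed

lemma card_avoiders_1234_1243:
  assumes "1 \<le> n"
  shows "card (avoiders n i [1,2,3,4] [1,2,4,3]) = card (tails n i)"
proof -
  have "avoiders n i [1,2,3,4] [1,2,4,3] = (#) i ` tails n i"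
  proof (intro equalityI subsetI)
    fix \<pi> assume \<pi>: "\<pi> \<in> avoiders n i [1,2,3,4] [1,2,4,3]"
    then have "\<pi> \<noteq> []" using assms by (auto simp: avoiders_def permutations_of_set_def)
    then obtain xs where xs: "\<pi> = i # xs" using \<pi> by (cases \<pi>) (auto simp: avoiders_def)
    have perm: "i # xs \<in> permutations_of_set {1..n}" using \<pi> by (simp add: avoiders_def xs)
    have "avoids (i # xs) [1,2,3,4] \<and> avoids (i # xs) [1,2,4,3]"
      using \<pi> unfolding avoiders_def xs by blast
    then have "few_above i xs"
      using avoids_1234_1243_Cons_iff[OF permutations_of_setD(2)[OF perm]] by (rule iffD1[rotated])
    then show "\<pi> \<in> (#) i ` tails n i" using perm by (simp add: tails_def xs)
  next
    fix \<pi> assume "\<pi> \<in> (#) i ` tails n i"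
    then obtain xs where xs: "\<pi> = i # xs" "i # xs \<in> permutations_of_set {1..n}" "few_above i xs"
      by (auto simp: tails_def)
    have "avoids (i # xs) [1,2,3,4] \<and> avoids (i # xs) [1,2,4,3]"
      using avoids_1234_1243_Cons_iff[OF permutations_of_setD(2)[OF xs(2)]] xs(3) by (rule iffD2)
    then show "\<pi> \<in> avoiders n i [1,2,3,4] [1,2,4,3]" using xs by (simp add: avoiders_def)
  qed
  then show ?thesis by (simp add: card_image)
qed

lemma Cons_Cons_permutation_swap:
  "x # y # zs \<in> permutations_of_set S \<longleftrightarrow> y # x # zs \<in> permutations_of_set S"
  by (auto simp: permutations_of_set_def)

lemma Cons_permutationD: "x # ys \<in> permutations_of_set S \<Longrightarrow> ys \<in> permutations_of_set (S - {x})"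
  by (auto simp: permutations_of_set_def)

text \<open>
  For an entry at the front of a permutation, the entries to its right are all the others, so the
  condition on larger entries becomes a condition on its value alone.
\<close>

lemma no_two_above_iff:
  fixes t :: nat
  assumes "t # xs \<in> permutations_of_set S"
  shows "\<not> (\<exists>c d. c < d \<and> d < length xs \<and> t < xs ! c \<and> t < xs ! d) \<longleftrightarrow>
    (\<forall>u\<in>S. \<forall>v\<in>S. t < u \<and> t < v \<longrightarrow> u = v)"
proof -
  have *: "distinct xs" "S = insert t (set xs)" using assms by (auto simp: permutations_of_set_def)
  have "(\<exists>c d. c < d \<and> d < length xs \<and> t < xs ! c \<and> t < xs ! d) \<longleftrightarrow>
    (\<exists>u\<in>set xs. \<exists>v\<in>set xs. u \<noteq> v \<and> t < u \<and> t < v)" (is "?l \<longleftrightarrow> ?r")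
  proof
    assume ?l
    then obtain c d where "c < d" "d < length xs" "t < xs ! c" "t < xs ! d" by blast
    moreover from this have "xs ! c \<noteq> xs ! d" using nth_eq_iff_index_eq[OF *(1), of c d] by simp
    moreover have "xs ! c \<in> set xs" "xs ! d \<in> set xs" using calculation by simp_all
    ultimately show ?r by blast
  next
    assume ?r
    then obtain c d where "c < length xs" "d < length xs" "c \<noteq> d" "t < xs ! c" "t < xs ! d"
      by (metis in_set_conv_nth)
    then show ?l using linorder_neqE_nat[of c d] by blast
  qed
  also have "\<dots> \<longleftrightarrow> (\<exists>u\<in>S. \<exists>v\<in>S. u \<noteq> v \<and> t < u \<and> t < v)" unfolding *(2) by simp
  finally show ?thesis by blast
qed

text \<open>
  A second entry \<open>j < k\<close> can replace \<open>k\<close> as the \<open>1\<close> of every pattern, so \<open>k\<close> imposes no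
  condition. A second entry \<open>t > k\<close> has to be one of the two largest values; then it starts no
  pattern, and being in front of all entries other than \<open>k\<close> it takes part in none as a later
  letter, except possibly as the \<open>2\<close>, which requires two larger entries. So again the
  rest is unconstrained by it.
\<close>

lemma tails_Suc:
  assumes "1 \<le> m" and k: "1 \<le> k" "k \<le> Suc m"
  shows "tails (Suc m) k =
    (\<Union>j\<in>{1..<k}. (\<lambda>xs. j # map (lift k) xs) ` tails m j) \<union>
    (\<Union>t\<in>{m, Suc m} \<inter> {k<..}. (\<lambda>xs. t # map (lift t) xs) ` tails m k)" (is "_ = ?D \<union> ?U")
proof (intro equalityI subsetI)
  fix ys assume ys: "ys \<in> tails (Suc m) k"
  then have perm: "k # ys \<in> permutations_of_set {1..Suc m}" by (simp add: tails_def)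
  then obtain zs where zs: "ys = map (lift k) zs" "zs \<in> permutations_of_set {1..m}"
    by (rule permutation_ConsE)
  then have "set zs = {1..m}" by (simp add: permutations_of_set_def)
  moreover from this obtain j xs where "zs = j # xs" using assms(1) by (cases zs) auto
  ultimately have j: "zs = j # xs" "1 \<le> j" by auto
  show "ys \<in> ?D \<union> ?U"
  proof (cases "j < k")
    case True
    then have "lift k j = j" by (simp add: lift_def)
    then have ysj: "ys = j # map (lift k) xs" using zs(1) j(1) by simp
    have "few_above k (j # map (lift k) xs)" using ys by (simp only: tails_def ysj mem_Collect_eq)
    then have "few_above j (map (lift k) xs)" by (rule few_above_Cons_less[OF True, THEN iffD1])
    then have "few_above j xs" using few_above_lift[of k j xs] \<open>lift k j = j\<close> by simp
    then have "xs \<in> tails m j" using zs(2) j(1) by (simp add: tails_def)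
    with ysj have "ys \<in> (\<lambda>xs. j # map (lift k) xs) ` tails m j" by (rule image_eqI)
    moreover have "j \<in> {1..<k}" using True j(2) by simp
    ultimately show ?thesis by (intro UnI1 UN_I)
  next
    case False
    \<comment> \<open>The entry \<open>j\<close> of the relabelled rest is the second entry \<open>j + 1\<close> of the permutation. It
      is moved to the front and deleted there.\<close>
    define t where "t = Suc j"
    have t: "lift k j = t" "k < t" using False by (auto simp: t_def lift_def)
    let ?us = "map (lift k) xs"
    have ysk: "ys = t # ?us" using zs j t by simp
    have "few_above k (t # ?us)" using ys by (simp only: tails_def ysk mem_Collect_eq)
    then have fa: "\<not> (\<exists>c d. c < d \<and> d < length ?us \<and> t < ?us ! c \<and> t < ?us ! d) \<and> few_above k ?us"
      by (rule few_above_Cons_greater[OF t(2), THEN iffD1])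
    have "t # k # ?us \<in> permutations_of_set {1..Suc m}"
      using perm unfolding ysk by (rule Cons_Cons_permutation_swap[THEN iffD1])
    then obtain ws where ws: "k # ?us = map (lift t) ws" "ws \<in> permutations_of_set {1..m}" "t \<in> {1..Suc m}"
      by (rule permutation_ConsE)
    then obtain k' vs where vs: "ws = k' # vs" "lift t k' = k" "?us = map (lift t) vs"
      by (cases ws) auto
    have k': "k' = k" using vs(2) t(2) by (auto simp: lift_def split: if_splits)
    have "few_above k vs" using fa vs few_above_lift[of t k vs] k' by simp
    then have vs_tails: "vs \<in> tails m k" using ws vs k' by (simp add: tails_def)
    have "t # ?us \<in> permutations_of_set ({1..Suc m} - {k})"
      using perm unfolding ysk by (rule Cons_permutationD)
    then have "\<forall>u\<in>{1..Suc m} - {k}. \<forall>v\<in>{1..Suc m} - {k}. t < u \<and> t < v \<longrightarrow> u = v"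
      by (rule no_two_above_iff[THEN iffD1]) (use fa in simp_all)
    then have "t < m \<longrightarrow> m = Suc m" using t(2) by (elim ballE[of _ _ m] ballE[of _ _ "Suc m"]) auto
    then have tm: "t \<in> {m, Suc m} \<inter> {k<..}" using ws(3) t(2) by auto
    have "ys = t # map (lift t) vs" using ysk vs(3) by simp
    then have "ys \<in> (\<lambda>xs. t # map (lift t) xs) ` tails m k" using vs_tails by (rule image_eqI)
    with tm show ?thesis by (intro UnI2 UN_I)
  qed
next
  fix ys assume "ys \<in> ?D \<union> ?U"
  then show "ys \<in> tails (Suc m) k"
  proof
    assume "ys \<in> ?D"
    then obtain j xs where j: "j \<in> {1..<k}" "xs \<in> tails m j" "ys = j # map (lift k) xs" by auto
    have "lift k j = j" using j(1) by (simp add: lift_def)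
    have "k # map (lift k) (j # xs) \<in> permutations_of_set {1..Suc m}"
      using j(2) k by (intro Cons_lift_permutation_iff[THEN iffD2]) (simp_all add: tails_def)
    moreover have "few_above j (map (lift k) xs)"
      using few_above_lift[of k j xs] \<open>lift k j = j\<close> j(2) by (simp add: tails_def)
    then have "few_above k (j # map (lift k) xs)"
      using j(1) few_above_Cons_less[of j k] by simp
    ultimately show ?thesis using \<open>lift k j = j\<close>
      by (simp only: tails_def j(3) mem_Collect_eq list.map simp_thms)
  next
    assume "ys \<in> ?U"
    then obtain t xs where t: "t \<in> {m, Suc m}" "k < t" "xs \<in> tails m k" "ys = t # map (lift t) xs"
      by auto
    let ?us = "map (lift t) xs"
    have lk: "lift t k = k" using t(2) by (simp add: lift_def)
    have "t \<in> {1..Suc m}" using t(1) assms(1) by auto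
    moreover have "k # xs \<in> permutations_of_set {1..m}" using t(3) by (simp only: tails_def mem_Collect_eq)
    ultimately have "t # k # ?us \<in> permutations_of_set {1..Suc m}"
      using Cons_lift_permutation_iff[of t m "k # xs"] lk by simp
    then have perm: "k # t # ?us \<in> permutations_of_set {1..Suc m}"
      by (rule Cons_Cons_permutation_swap[THEN iffD1])
    then have "t # ?us \<in> permutations_of_set ({1..Suc m} - {k})" by (rule Cons_permutationD)
    then have "\<not> (\<exists>c d. c < d \<and> d < length ?us \<and> t < ?us ! c \<and> t < ?us ! d)"
      by (rule no_two_above_iff[THEN iffD2]) (use t(1) in auto)
    moreover have "few_above k ?us" using few_above_lift[of t k xs] lk t(3) by (simp add: tails_def)
    ultimately have "few_above k (t # ?us)"
      by (intro few_above_Cons_greater[OF t(2), THEN iffD2] conjI)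
    then show ?thesis using perm by (simp only: tails_def t(4) mem_Collect_eq simp_thms)
  qed
qed

lemma card_tails_Suc:
  assumes "1 \<le> m" and "1 \<le> k" "k \<le> Suc m"
  shows "card (tails (Suc m) k) =
    (\<Sum>j\<in>{1..<k}. card (tails m j)) + card ({m, Suc m} \<inter> {k<..}) * card (tails m k)"
proof -
  have inj: "inj_on (\<lambda>xs. j # map (lift t) xs) S" for j t S
    using inj_lift[of t] by (auto simp: inj_on_def)
  have "card (\<Union>j\<in>{1..<k}. (\<lambda>xs. j # map (lift k) xs) ` tails m j) = (\<Sum>j\<in>{1..<k}. card (tails m j))"
    by (subst card_UN_disjoint) (auto simp: finite_tails card_image[OF inj])
  moreover have "card (\<Union>t\<in>{m, Suc m} \<inter> {k<..}. (\<lambda>xs. t # map (lift t) xs) ` tails m k) =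
      card ({m, Suc m} \<inter> {k<..}) * card (tails m k)"
    by (subst card_UN_disjoint) (auto simp: finite_tails card_image[OF inj])
  ultimately show ?thesis
    unfolding tails_Suc[OF assms] by (subst card_Un_disjoint) (auto simp: finite_tails)
qed

text \<open>
  For \<open>k < m\<close> this is the defining recurrence summed over the second argument. For \<open>k = m\<close> and
  \<open>k = m + 1\<close> it expresses that the last three entries of a row agree, where the identity for
  \<open>k = m - 1\<close> is rewritten by means of the equality of the last two entries of the row before.
\<close>

lemma schroeder_array_Suc:
  assumes "1 \<le> m" and "1 \<le> k" "k \<le> Suc m"
  shows "schroeder_array (Suc m) k =
    (\<Sum>j\<in>{1..<k}. schroeder_array m j) + int (card ({m, Suc m} \<inter> {k<..})) * schroeder_array m k"
proof -
  have low: "schroeder_array (Suc m) k = (\<Sum>j\<in>{1..<k}. schroeder_array m j) + 2 * schroeder_array m k"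
    if "1 \<le> k" "k < m" for k
    using that
  proof (induction k rule: dec_induct)
    case base
    have "schroeder_array (Suc m) 0 = 0" "schroeder_array m 0 = 0"
      by (simp_all add: schroeder_array.simps)
    then show ?case using base by (subst schroeder_array.simps) auto
  next
    case (step k)
    have "schroeder_array (Suc m) (Suc k) =
      schroeder_array (Suc m) k + 2 * schroeder_array m (Suc k) - schroeder_array m k"
      using step by (subst schroeder_array.simps) auto
    moreover have "(\<Sum>j\<in>{1..<Suc k}. schroeder_array m j) = (\<Sum>j\<in>{1..<k}. schroeder_array m j) + schroeder_array m k"
      using step by simp
    ultimately show ?case using step by simp
  qed
  have high: "schroeder_array (Suc m) k = (\<Sum>j\<in>{1..<Suc m}. schroeder_array m j)" if "m \<le> k" "k \<le> Suc m" for k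
  proof (cases "m = 1")
    case True
    then show ?thesis using that by (simp add: schroeder_array.simps)
  next
    case False
    then obtain p where p: "m = Suc p" "1 \<le> p" using assms(1) by (cases m) auto
    have "schroeder_array (Suc m) k = schroeder_array (Suc m) p"
      using p that by (subst schroeder_array.simps) auto
    also have "\<dots> = (\<Sum>j\<in>{1..<p}. schroeder_array m j) + 2 * schroeder_array m p"
      using low[of p] p by simp
    also have "schroeder_array m m = schroeder_array m p"
    proof (cases "p = 1")
      case True
      then show ?thesis using p by (simp add: schroeder_array.simps)
    next
      case False
      have "schroeder_array m m = schroeder_array m (m - 2)"
        using p False by (subst schroeder_array.simps) auto
      moreover have "schroeder_array m p = schroeder_array m (m - 2)"
        using p False by (subst schroeder_array.simps) auto
      ultimately show ?thesis by simp
    qed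
    then have "(\<Sum>j\<in>{1..<p}. schroeder_array m j) + 2 * schroeder_array m p =
        (\<Sum>j\<in>{1..<Suc m}. schroeder_array m j)"
      using p by simp
    finally show ?thesis .
  qed
  consider "k < m" | "k = m" | "k = Suc m" using assms by linarith
  then show ?thesis
  proof cases
    case 1
    then have "{m, Suc m} \<inter> {k<..} = {m, Suc m}" by auto
    then show ?thesis using low[of k] 1 assms by simp
  next
    case 2
    then have "{m, Suc m} \<inter> {k<..} = {Suc m}" by auto
    then show ?thesis using high[of k] 2 assms by simp
  next
    case 3
    then have "{m, Suc m} \<inter> {k<..} = {}" by auto
    then show ?thesis using high[of k] 3 assms by simp
  qed
qed

lemma card_tails:
  assumes "1 \<le> n" and "1 \<le> k" "k \<le> n"
  shows "int (card (tails n k)) = schroeder_array n k"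
  using assms
proof (induction n arbitrary: k rule: dec_induct)
  case base
  then have "k = 1" by simp
  moreover have "permutations_of_set {1..1::nat} = {[1]}" by simp
  then have "tails 1 1 = {[]}" unfolding tails_def by auto
  ultimately show ?case by (simp add: schroeder_array.simps)
next
  case (step m)
  have "(\<Sum>j\<in>{1..<k}. int (card (tails m j))) = (\<Sum>j\<in>{1..<k}. schroeder_array m j)"
    using step by (intro sum.cong) auto
  moreover have "int (card ({m, Suc m} \<inter> {k<..})) * int (card (tails m k)) =
      int (card ({m, Suc m} \<inter> {k<..})) * schroeder_array m k"
  proof (cases "k \<le> m")
    case False
    then have "{m, Suc m} \<inter> {k<..} = {}" by auto
    then show ?thesis by simp
  qed (use step in simp)
  ultimately show ?case
    using step card_tails_Suc[of m k] schroeder_array_Suc[of m k] by simp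
qed

theorem theorem3:
  fixes n i :: nat
  assumes "1 \<le> n" and "1 \<le> i" and "i \<le> n"
  shows "(\<forall>M \<subseteq> {1..n} \<times> {1..n}. \<exists>f. bij_betw f
            {\<pi> \<in> avoiders n i [1,3,4,2] [1,4,3,2]. lr_minima \<pi> = M}
            {\<pi> \<in> avoiders n i [1,2,3,4] [1,2,4,3]. lr_minima \<pi> = M})
       \<and> int (card (avoiders n i [1,3,4,2] [1,4,3,2])) = schroeder_array n i"
proof
  have fin: "finite (avoiders n i \<sigma> \<tau>)" for \<sigma> \<tau> by (simp add: avoiders_def)
  show "\<forall>M \<subseteq> {1..n} \<times> {1..n}. \<exists>f. bij_betw f
            {\<pi> \<in> avoiders n i [1,3,4,2] [1,4,3,2]. lr_minima \<pi> = M}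
            {\<pi> \<in> avoiders n i [1,2,3,4] [1,2,4,3]. lr_minima \<pi> = M}"
    using fin card_avoiders_given_lr_minima[OF assms(1), of i]
    by (intro allI impI finite_same_card_bij) auto
  have by_minima: "card (avoiders n i \<sigma> \<tau>) =
      (\<Sum>M \<in> Pow ({1..n} \<times> {1..n}). card {\<pi> \<in> avoiders n i \<sigma> \<tau>. lr_minima \<pi> = M})" for \<sigma> \<tau>
  proof -
    have "lr_minima \<pi> \<subseteq> {1..n} \<times> {1..n}" if "\<pi> \<in> avoiders n i \<sigma> \<tau>" for \<pi>
    proof -
      have "set \<pi> = {1..n}" "length \<pi> = n"
        using that distinct_card[of \<pi>] by (auto simp: avoiders_def permutations_of_set_def)
      then show ?thesis using nth_mem[of _ \<pi>] by (force simp: lr_minima_def)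
    qed
    then have "lr_minima ` avoiders n i \<sigma> \<tau> \<subseteq> Pow ({1..n} \<times> {1..n})" by blast
    from sum.group[OF fin _ this, of "\<lambda>_. 1::nat"] show ?thesis by simp
  qed
  have "card (avoiders n i [1,3,4,2] [1,4,3,2]) = card (avoiders n i [1,2,3,4] [1,2,4,3])"
    unfolding by_minima card_avoiders_given_lr_minima[OF assms(1)] ..
  then show "int (card (avoiders n i [1,3,4,2] [1,4,3,2])) = schroeder_array n i"
    using card_avoiders_1234_1243[OF assms(1)] card_tails[OF assms] by simp
qed

end
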